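(* Let $(2n)!!=\prod_{i=1}^n(2i)$, $(2n-1)!!=\prod_{i=1}^n(2i-1)$ for $n\ge1$, and $0!!=1$. Writing $P(x)|_{x^k}$ for the coefficient of $x^k$ in a polynomial $P$: (1) for all $n\ge1$, $A_{2n}(x)|_{x^k}=0$ for $0\le k<n$ and $A_{2n}(x)|_{x^n}=(2n-1)!!$; (2) for all $n\ge1$, $B_{2n+1}(x)|_{x^k}=0$ for $0\le k<n$ and $B_{2n+1}(x)|_{x^n}=(2n)!!$; (3) for all $n\ge1$, $C_{2n}(x)|_{x^k}=0$ for $0\le k<n-1$ and $C_{2n}(x)|_{x^{n-1}}=(2(n-1))!!$; (4) for all $n\ge1$, $D_{2n+1}(x)|_{x^k}=0$ for $0\le k<n$ and $D_{2n+1}(x)|_{x^n}=(2n-1)!!$.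
   Context: For $\sigma=\sigma_1\ldots\sigma_n\in S_n$, let $\mathrm{mmp}^{(1,0,0,0)}(\sigma)$ be the number of indices $i$ such that there exists $j>i$ with $\sigma_j>\sigma_i$. $UD_n$ is the set of up-down permutations in $S_n$ ($\sigma_1<\sigma_2>\sigma_3<\cdots$) and $DU_n$ the set of down-up permutations ($\sigma_1>\sigma_2<\sigma_3>\cdots$). For $m\ge1$: $A_{2m}(x)=\sum_{\sigma\in UD_{2m}}x^{\mathrm{mmp}^{(1,0,0,0)}(\sigma)}$, $B_{2m-1}(x)=\sum_{\sigma\in UD_{2m-1}}x^{\mathrm{mmp}^{(1,0,0,0)}(\sigma)}$, $C_{2m}(x)=\sum_{\sigma\in DU_{2m}}x^{\mathrm{mmp}^{(1,0,0,0)}(\sigma)}$, $D_{2m-1}(x)=\sum_{\sigma\in DU_{2m-1}}x^{\mathrm{mmp}^{(1,0,0,0)}(\sigma)}$. *)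

theory Defs
  imports "HOL-Combinatorics.Permutations" "HOL-Computational_Algebra.Polynomial"
begin

(* A permutation in S_n is a function p with "p permutes {1..n}"; its one-line notation
   is p 1, ..., p n, so positions and values both start at 1. *)

definition mmp1000 :: "nat \<Rightarrow> (nat \<Rightarrow> nat) \<Rightarrow> nat" where
  "mmp1000 n \<sigma> = card {i \<in> {1..n}. \<exists>j \<in> {1..n}. i < j \<and> \<sigma> i < \<sigma> j}"

definition UD :: "nat \<Rightarrow> (nat \<Rightarrow> nat) set" where
  "UD n = {\<sigma>. \<sigma> permutes {1..n} \<and>
     (\<forall>i \<in> {1..<n}. if odd i then \<sigma> i < \<sigma> (i + 1) else \<sigma> i > \<sigma> (i + 1))}"

definition DU :: "nat \<Rightarrow> (nat \<Rightarrow> nat) set" where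
  "DU n = {\<sigma>. \<sigma> permutes {1..n} \<and>
     (\<forall>i \<in> {1..<n}. if odd i then \<sigma> i > \<sigma> (i + 1) else \<sigma> i < \<sigma> (i + 1))}"

(* The argument is the length of the permutations, i.e. the subscript itself: it is meant to
   be even for A_poly and C_poly, and odd for B_poly and D_poly. *)

definition A_poly :: "nat \<Rightarrow> int poly" where
  "A_poly N = (\<Sum>\<sigma> \<in> UD N. monom 1 (mmp1000 N \<sigma>))"

definition B_poly :: "nat \<Rightarrow> int poly" where
  "B_poly N = (\<Sum>\<sigma> \<in> UD N. monom 1 (mmp1000 N \<sigma>))"

definition C_poly :: "nat \<Rightarrow> int poly" where
  "C_poly N = (\<Sum>\<sigma> \<in> DU N. monom 1 (mmp1000 N \<sigma>))"

definition D_poly :: "nat \<Rightarrow> int poly" where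
  "D_poly N = (\<Sum>\<sigma> \<in> DU N. monom 1 (mmp1000 N \<sigma>))"

(* N = 2n in the even case and N = 2n - 1 with n = (N + 1) div 2 in the odd case;
   0!! = 1 is the empty product. *)
definition double_fact :: "nat \<Rightarrow> nat" where
  "double_fact N = (if even N then \<Prod>i = 1..N div 2. 2 * i
                    else \<Prod>i = 1..(N + 1) div 2. 2 * i - 1)"

end

theory Submission
  imports Defs
begin

text \<open>
  In an alternating permutation every ascent bottom (valley) has a larger entry to its right, which
  gives the lower bound on the statistic. Equality holds iff every other entry is larger than
  everything after it. Removing the first valley a together with the peak that follows it, which must
  be the maximum, leaves a permutation of the same kind, and a may be any non-maximal entry. Hence the
  number f(N) of minimal up-down permutations satisfies f(N) = (N - 1) f(N - 2). A minimal down-up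
  permutation starts with its maximum, and deleting it leaves a minimal up-down permutation.
\<close>

section \<open>Enumeration of the minimal permutations as lists\<close>

text \<open>The product gains exactly the factor \<open>N + 2\<close> in either parity, so one
  recurrence serves both kinds of double factorial.\<close>

lemma double_fact_Suc_Suc: "double_fact (Suc (Suc N)) = Suc (Suc N) * double_fact N"
proof (cases "even N")
  case True
  then obtain m where "N = 2 * m" by blast
  then show ?thesis by (simp add: double_fact_def)
next
  case False
  then obtain m where "N = 2 * m + 1" by (elim oddE)
  then show ?thesis by (simp add: double_fact_def)
qed

text \<open>The flag tells whether the first entry is a valley.\<close>

fun dominant_peaks :: "bool \<Rightarrow> nat list \<Rightarrow> bool" where
  "dominant_peaks v [] = True"
| "dominant_peaks v (x # xs) =
     ((if v then xs \<noteq> [] \<longrightarrow> x < hd xs else \<forall>y \<in> set xs. y < x) \<and> dominant_peaks (\<not> v) xs)"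

text \<open>Arbitrary value sets \<open>S\<close> are allowed because deleting entries leaves gaps;
  this avoids renumbering the values.\<close>

definition dominant_lists :: "bool \<Rightarrow> nat set \<Rightarrow> nat list set" where
  "dominant_lists v S = {xs. distinct xs \<and> set xs = S \<and> dominant_peaks v xs}"

lemma finite_dominant_lists: "finite S \<Longrightarrow> finite (dominant_lists v S)"
  unfolding dominant_lists_def
  by (rule finite_subset[OF _ finite_subset_distinct]) auto

lemma dominant_lists_empty [simp]: "dominant_lists v {} = {[]}"
  by (auto simp: dominant_lists_def)

text \<open>A leading entry that is not a valley must exceed all others, so it is forced to be the
  maximum and puts no condition on the tail.\<close>

lemma dominant_lists_False:
  assumes "finite S" "S \<noteq> {}"
  shows "dominant_lists False S = (#) (Max S) ` dominant_lists True (S - {Max S})"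
proof (intro equalityI subsetI)
  fix ys assume ys: "ys \<in> dominant_lists False S"
  with assms obtain y xs where eq: "ys = y # xs"
    by (cases ys) (auto simp: dominant_lists_def)
  with ys have *: "distinct (y # xs)" "set (y # xs) = S" "\<forall>z \<in> set xs. z < y" "dominant_peaks True xs"
    by (auto simp: dominant_lists_def)
  then have "Max S = y"
    by (intro Max_eqI) auto
  with * eq show "ys \<in> (#) (Max S) ` dominant_lists True (S - {Max S})"
    by (auto simp: dominant_lists_def)
next
  fix ys assume "ys \<in> (#) (Max S) ` dominant_lists True (S - {Max S})"
  then obtain xs where *: "ys = Max S # xs" "distinct xs" "set xs = S - {Max S}" "dominant_peaks True xs"
    by (auto simp: dominant_lists_def)
  moreover have "z < Max S" if "z \<in> S - {Max S}" for z
    using that assms by (simp add: order.not_eq_order_implies_strict)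
  moreover have "insert (Max S) S = S"
    using assms by (simp add: insert_absorb)
  ultimately show "ys \<in> dominant_lists False S"
    by (simp add: dominant_lists_def)
qed

text \<open>The entry after the valley \<open>a\<close> is forced to be
  \<open>Max (S - {a})\<close>, so the only restriction on \<open>a\<close> is to lie below it. With
  a single value there is no next entry, and the valley is then the maximum itself.\<close>

lemma dominant_lists_True:
  assumes "finite S" "card S \<ge> 2"
  shows "dominant_lists True S = (\<Union>a \<in> S - {Max S}. (#) a ` dominant_lists False (S - {a}))"
proof -
  have Cons: "a # xs \<in> dominant_lists True S \<longleftrightarrow> a \<noteq> Max S"
    if a: "a \<in> S" and xs: "xs \<in> dominant_lists False (S - {a})" for a xs
  proof -
    have "S - {a} \<noteq> {}"
    proof
      assume "S - {a} = {}"
      with a have "S = {a}" by blast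
      with assms(2) show False by simp
    qed
    with xs assms(1) have hd: "hd xs = Max (S - {a})" "xs \<noteq> []"
      by (auto simp: dominant_lists_False)
    \<comment> \<open>If \<open>a\<close> is not \<open>Max S\<close>, then \<open>Max S\<close>
      survives the removal of \<open>a\<close> and is larger than \<open>a\<close>.\<close>
    have "a < Max (S - {a}) \<longleftrightarrow> a \<noteq> Max S"
    proof
      assume "a < Max (S - {a})"
      also have "Max (S - {a}) \<le> Max S"
        using \<open>S - {a} \<noteq> {}\<close> assms(1) by (intro Max_mono) auto
      finally show "a \<noteq> Max S" by simp
    next
      assume "a \<noteq> Max S"
      moreover have "Max S \<in> S" using a assms(1) by (intro Max_in) auto
      ultimately have "a < Max S" "Max S \<in> S - {a}"
        using a assms(1) by (auto simp: order.not_eq_order_implies_strict)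
      then show "a < Max (S - {a})"
        using assms(1) by (meson Max_ge finite_Diff less_le_trans)
    qed
    with hd a xs show ?thesis
      by (auto simp: dominant_lists_def)
  qed
  show ?thesis
  proof (intro equalityI subsetI)
    fix ys assume ys: "ys \<in> dominant_lists True S"
    with assms obtain a xs where eq: "ys = a # xs"
      by (cases ys) (auto simp: dominant_lists_def)
    with ys have "a \<in> S" "xs \<in> dominant_lists False (S - {a})"
      by (auto simp: dominant_lists_def)
    moreover from this Cons ys eq have "a \<noteq> Max S"
      by blast
    ultimately show "ys \<in> (\<Union>a \<in> S - {Max S}. (#) a ` dominant_lists False (S - {a}))"
      using eq by blast
  next
    fix ys assume "ys \<in> (\<Union>a \<in> S - {Max S}. (#) a ` dominant_lists False (S - {a}))"
    then obtain a xs where "a \<in> S" "a \<noteq> Max S" "ys = a # xs" "xs \<in> dominant_lists False (S - {a})"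
      by blast
    with Cons show "ys \<in> dominant_lists True S"
      by blast
  qed
qed

lemma card_dominant_lists_False:
  assumes "finite S" "S \<noteq> {}"
  shows "card (dominant_lists False S) = card (dominant_lists True (S - {Max S}))"
  using assms by (simp add: dominant_lists_False card_image)

text \<open>Strong induction in steps of two: choose a non-maximal first valley, remove it and the
  forced peak after it. By truncated subtraction both base cases, 0 and 1 values, read
  \<open>double_fact 0 = 1\<close>.\<close>

lemma card_dominant_lists_True:
  assumes "finite S"
  shows "card (dominant_lists True S) = double_fact (card S - 1)"
  using assms
proof (induction "card S" arbitrary: S rule: less_induct)
  case less
  show ?case
  proof (cases "card S \<ge> 2")
    case False
    then consider "card S = 0" | "card S = 1" by linarith
    then show ?thesis
    proof cases
      case 1
      with less.prems show ?thesis by (simp add: double_fact_def)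
    next
      case 2
      then obtain x where "S = {x}" by (auto simp: card_1_singleton_iff)
      moreover have "dominant_lists True {x} = {[x]}"
      proof (intro equalityI subsetI)
        fix xs assume "xs \<in> dominant_lists True {x}"
        then have xs: "distinct xs" "set xs = {x}"
          by (auto simp: dominant_lists_def)
        with distinct_card[of xs] have "length xs = 1" by simp
        then obtain y where "xs = [y]"
          by (cases xs) auto
        with xs(2) show "xs \<in> {[x]}" by simp
      qed (auto simp: dominant_lists_def)
      ultimately show ?thesis by (simp add: double_fact_def)
    qed
  next
    case True
    define k where "k = card S - 2"
    with True have k: "card S = Suc (Suc k)" by linarith
    have "S \<noteq> {}" using True by auto
    have step: "card ((#) a ` dominant_lists False (S - {a})) = double_fact (k - 1)"
      if a: "a \<in> S" for a
    proof -
      let ?T = "S - {a}"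
      have T: "finite ?T" "card ?T = Suc k"
        using a less.prems k by simp_all
      then have "?T \<noteq> {}" by (intro notI) (simp only: card.empty)
      then have cT: "card (?T - {Max ?T}) = k"
        using T by (subst card_Diff_singleton) (use Max_in[of ?T] in auto)
      then have "card (dominant_lists True (?T - {Max ?T})) = double_fact (k - 1)"
        using less.hyps[of "?T - {Max ?T}"] k T by simp
      with \<open>?T \<noteq> {}\<close> T show ?thesis
        by (simp add: card_image card_dominant_lists_False)
    qed
    \<comment> \<open>The images for different \<open>a\<close> are disjoint because their lists
      have different heads, and by \<open>step\<close> they all have the same size.\<close>
    have "card (dominant_lists True S) =
        (\<Sum>a \<in> S - {Max S}. card ((#) a ` dominant_lists False (S - {a})))"
      unfolding dominant_lists_True[OF less.prems True]
      using less.prems by (intro card_UN_disjoint) (auto simp: finite_dominant_lists)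
    also have "\<dots> = card (S - {Max S}) * double_fact (k - 1)"
      by (simp add: step)
    also have "\<dots> = Suc k * double_fact (k - 1)"
      using less.prems \<open>S \<noteq> {}\<close> k by simp
    also have "\<dots> = double_fact (Suc k)"
      \<comment> \<open>For \<open>k = 0\<close> the term \<open>k - 1\<close> truncates to 0,
        outside the recurrence; there \<open>double_fact 0\<close> and \<open>double_fact 1\<close>
        are both 1.\<close>
      by (cases k) (simp_all add: double_fact_Suc_Suc, simp add: double_fact_def)
    finally show ?thesis using k by simp
  qed
qed

section \<open>Minimality of the statistic for alternating permutations\<close>

text \<open>Writing the flag as \<open>odd m = v\<close> ties it to absolute positions: it flips by
  itself when \<open>m\<close> becomes \<open>Suc m\<close>, so the induction on
  \<open>n - m\<close> goes through with \<open>v\<close> fixed.\<close>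

lemma dominant_peaks_map_upt:
  "dominant_peaks (odd m = v) (map \<sigma> [m..<n]) \<longleftrightarrow>
     (\<forall>i \<in> {m..<n}. if odd i = v then Suc i < n \<longrightarrow> \<sigma> i < \<sigma> (Suc i)
                    else \<forall>j \<in> {i<..<n}. \<sigma> j < \<sigma> i)"
proof (induction "n - m" arbitrary: m)
  case 0
  then show ?case by simp
next
  case (Suc d)
  then have "m < n" and d: "d = n - Suc m" by auto
  have "{m..<n} = insert m {Suc m..<n}" "{m<..<n} = {Suc m..<n}"
    using \<open>m < n\<close> by auto
  moreover have "(\<not> (odd m = v)) = (odd (Suc m) = v)" by auto
  moreover have "[Suc m..<n] \<noteq> [] \<longleftrightarrow> Suc m < n" by auto
  moreover have "hd (map \<sigma> [Suc m..<n]) = \<sigma> (Suc m)" if "Suc m < n"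
    using that by (simp add: upt_conv_Cons)
  ultimately show ?case
    using Suc(1)[OF d] \<open>m < n\<close> by (simp add: upt_conv_Cons)
qed

text \<open>Treats up-down (\<open>v = True\<close>) and down-up (\<open>v = False\<close>)
  permutations together; \<open>odd i = v\<close> says that position \<open>i\<close> is a
  valley.\<close>

definition alternating_perms :: "bool \<Rightarrow> nat \<Rightarrow> (nat \<Rightarrow> nat) set" where
  "alternating_perms v n = {\<sigma>. \<sigma> permutes {1..n} \<and>
     (\<forall>i \<in> {1..<n}. if odd i = v then \<sigma> i < \<sigma> (i + 1) else \<sigma> i > \<sigma> (i + 1))}"

lemma UD_eq_alternating_perms: "UD n = alternating_perms True n"
  by (simp add: UD_def alternating_perms_def)

lemma DU_eq_alternating_perms: "DU n = alternating_perms False n"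
  unfolding DU_def alternating_perms_def by (intro Collect_cong conj_cong ball_cong) auto

lemma finite_alternating_perms: "finite (alternating_perms v n)"
  by (rule finite_subset[OF _ finite_permutations[of "{1..n}"]]) (auto simp: alternating_perms_def)

text \<open>This number is the lowest exponent. Position \<open>n\<close> is left out, since a
  valley there has no entry to its right.\<close>

lemma card_valleys:
  "card {i \<in> {1..<n}. odd i = v} = (if v then n div 2 else (n - 1) div 2)"
proof (induction n)
  case (Suc n)
  have "{i \<in> {1..<Suc n}. odd i = v} =
      (if n \<ge> 1 \<and> odd n = v then insert n else id) {i \<in> {1..<n}. odd i = v}"
    by (auto simp: less_Suc_eq)
  then have "card {i \<in> {1..<Suc n}. odd i = v} =
      card {i \<in> {1..<n}. odd i = v} + (if n \<ge> 1 \<and> odd n = v then 1 else 0)"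
    by auto
  also have "\<dots> = (if v then Suc n div 2 else (Suc n - 1) div 2)"
    unfolding Suc by (cases v; cases n) simp_all
  finally show ?case .
qed simp

text \<open>Every valley in \<open>V\<close> is counted because the next entry is larger. Equality
  holds exactly when nothing else is counted, that is, when each peak position dominates all later
  ones.\<close>

lemma alternating_perms_mmp1000:
  assumes "\<sigma> \<in> alternating_perms v n"
  defines "V \<equiv> {i \<in> {1..<n}. odd i = v}"
  shows "card V \<le> mmp1000 n \<sigma>"
    and "mmp1000 n \<sigma> = card V \<longleftrightarrow> dominant_peaks v (map \<sigma> [1..<Suc n])"
proof -
  define M where "M = {i \<in> {1..n}. \<exists>j \<in> {1..n}. i < j \<and> \<sigma> i < \<sigma> j}"
  have mmp: "mmp1000 n \<sigma> = card M"
    by (simp add: mmp1000_def M_def)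
  have "finite M" by (simp add: M_def)
  have up: "\<sigma> i < \<sigma> (Suc i)" if "i \<in> V" for i
    using that assms(1) by (force simp: V_def alternating_perms_def)
  have sub: "V \<subseteq> M"
  proof
    fix i assume "i \<in> V"
    with up[of i] show "i \<in> M"
      by (auto simp: V_def M_def intro!: bexI[of _ "Suc i"])
  qed
  with \<open>finite M\<close> show "card V \<le> mmp1000 n \<sigma>"
    by (simp add: mmp card_mono)
  have inj: "\<sigma> i \<noteq> \<sigma> j" if "i \<noteq> j" for i j
    using that assms(1) by (auto simp: alternating_perms_def dest: permutes_inj injD)
  have "mmp1000 n \<sigma> = card V \<longleftrightarrow> M \<subseteq> V"
    using sub \<open>finite M\<close> card_subset_eq[of M V] by (auto simp: mmp)
  also have "\<dots> \<longleftrightarrow> (\<forall>i \<in> {1..n}. odd i \<noteq> v \<longrightarrow> (\<forall>j \<in> {i<..n}. \<sigma> j < \<sigma> i))"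
  proof
    assume MV: "M \<subseteq> V"
    show "\<forall>i \<in> {1..n}. odd i \<noteq> v \<longrightarrow> (\<forall>j \<in> {i<..n}. \<sigma> j < \<sigma> i)"
    proof (intro ballI impI)
      fix i j assume ij: "i \<in> {1..n}" "odd i \<noteq> v" "j \<in> {i<..n}"
      then have "i \<notin> M" using MV by (auto simp: V_def)
      with ij inj[of i j] show "\<sigma> j < \<sigma> i"
        by (force simp: M_def)
    qed
  next
    assume *: "\<forall>i \<in> {1..n}. odd i \<noteq> v \<longrightarrow> (\<forall>j \<in> {i<..n}. \<sigma> j < \<sigma> i)"
    show "M \<subseteq> V"
    proof
      fix i assume "i \<in> M"
      then obtain j where "i \<in> {1..n}" "j \<in> {i<..n}" "\<sigma> i < \<sigma> j" by (auto simp: M_def)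
      \<comment> \<open>The witness \<open>j\<close> satisfies \<open>i < j \<le> n\<close>, so
        \<open>i < n\<close>, as membership in \<open>V\<close> demands.\<close>
      moreover from this * have "odd i = v" by (meson less_asym)
      ultimately show "i \<in> V" by (auto simp: V_def)
    qed
  qed
  also have "\<dots> \<longleftrightarrow> dominant_peaks (odd (1::nat) = v) (map \<sigma> [1..<Suc n])"
    unfolding dominant_peaks_map_upt
  proof (rule ball_cong)
    fix i assume i: "i \<in> {1..<Suc n}"
    \<comment> \<open>The valley clause holds automatically for an alternating permutation; only the
      peak clause carries information.\<close>
    then have "odd i = v \<longrightarrow> Suc i < Suc n \<longrightarrow> \<sigma> i < \<sigma> (Suc i)"
      using up[of i] by (simp add: V_def)
    moreover have "{i<..<Suc n} = {i<..n}" by auto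
    ultimately show "(odd i \<noteq> v \<longrightarrow> (\<forall>j \<in> {i<..n}. \<sigma> j < \<sigma> i)) \<longleftrightarrow>
        (if odd i = v then Suc i < Suc n \<longrightarrow> \<sigma> i < \<sigma> (Suc i)
         else \<forall>j \<in> {i<..<Suc n}. \<sigma> j < \<sigma> i)"
      by (cases v; cases "even i") simp_all
  qed auto
  finally show "mmp1000 n \<sigma> = card V \<longleftrightarrow> dominant_peaks v (map \<sigma> [1..<Suc n])"
    by simp
qed

text \<open>A peak larger than all later entries is in particular larger than the next one, so
  dominance already contains alternation.\<close>

lemma dominant_peaks_imp_alternating:
  assumes "\<sigma> permutes {1..n}" "dominant_peaks v (map \<sigma> [1..<Suc n])"
  shows "\<sigma> \<in> alternating_perms v n"
proof -
  have "dominant_peaks (odd (1::nat) = v) (map \<sigma> [1..<Suc n])"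
    using assms(2) by simp
  then have *: "if odd i = v then Suc i < Suc n \<longrightarrow> \<sigma> i < \<sigma> (Suc i)
      else \<forall>j \<in> {i<..<Suc n}. \<sigma> j < \<sigma> i" if "i \<in> {1..<Suc n}" for i
    using that unfolding dominant_peaks_map_upt by blast
  have "if odd i = v then \<sigma> i < \<sigma> (i + 1) else \<sigma> i > \<sigma> (i + 1)" if "i \<in> {1..<n}" for i
    using that *[of i] by (auto split: if_splits)
  with assms(1) show ?thesis
    unfolding alternating_perms_def by blast
qed

section \<open>Transfer of the count through one-line notation\<close>

lemma bij_betw_permutes_distinct_lists:
  "bij_betw (\<lambda>\<sigma>. map \<sigma> [1..<Suc n]) {\<sigma>. \<sigma> permutes {1..n}} {xs. distinct xs \<and> set xs = {1..n}}"
proof (rule bij_betw_imageI)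
  show "inj_on (\<lambda>\<sigma>. map \<sigma> [1..<Suc n]) {\<sigma>. \<sigma> permutes {1..n}}"
  proof (rule inj_onI, rule ext)
    fix \<sigma> \<tau> :: "nat \<Rightarrow> nat" and i
    assume *: "\<sigma> \<in> {\<sigma>. \<sigma> permutes {1..n}}" "\<tau> \<in> {\<sigma>. \<sigma> permutes {1..n}}"
      "map \<sigma> [1..<Suc n] = map \<tau> [1..<Suc n]"
    show "\<sigma> i = \<tau> i"
    proof (cases "i \<in> {1..n}")
      case True
      with *(3) show ?thesis by (simp add: map_eq_conv del: upt_Suc)
    next
      \<comment> \<open>Outside \<open>{1..n}\<close> both permutations are the identity, so the
        list determines them everywhere.\<close>
      case False
      with * show ?thesis by (metis mem_Collect_eq permutes_not_in)
    qed
  qed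
  show "(\<lambda>\<sigma>. map \<sigma> [1..<Suc n]) ` {\<sigma>. \<sigma> permutes {1..n}} = {xs. distinct xs \<and> set xs = {1..n}}"
  proof (intro equalityI subsetI)
    fix xs assume "xs \<in> (\<lambda>\<sigma>. map \<sigma> [1..<Suc n]) ` {\<sigma>. \<sigma> permutes {1..n}}"
    then obtain \<sigma> where "\<sigma> permutes {1..n}" "xs = map \<sigma> [1..<Suc n]" by blast
    moreover have "{1..<Suc n} = {1..n}" by auto
    ultimately show "xs \<in> {xs. distinct xs \<and> set xs = {1..n}}"
      by (auto simp: distinct_map permutes_inj_on permutes_image simp del: upt_Suc)
  next
    fix xs :: "nat list" assume "xs \<in> {xs. distinct xs \<and> set xs = {1..n}}"
    then have xs: "distinct xs" "set xs = {1..n}" by auto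
    with distinct_card[of xs] have len: "length xs = n" by simp
    \<comment> \<open>List indices start at 0 and positions at 1, hence
      \<open>i - 1\<close>.\<close>
    define \<sigma> where "\<sigma> i = (if i \<in> {1..n} then xs ! (i - 1) else i)" for i
    have map: "map \<sigma> [1..<Suc n] = xs"
      by (rule nth_equalityI) (simp_all add: len \<sigma>_def nth_upt del: upt_Suc)
    have "set (map \<sigma> [1..<Suc n]) = \<sigma> ` {1..n}"
      by (auto simp del: upt_Suc)
    then have "\<sigma> ` {1..n} = {1..n}" using map xs(2) by metis
    \<comment> \<open>A map of a finite set onto itself is injective.\<close>
    then have "bij_betw \<sigma> {1..n} {1..n}"
      by (simp add: bij_betw_def eq_card_imp_inj_on)
    then have "\<sigma> permutes {1..n}"
      by (rule bij_imp_permutes) (auto simp: \<sigma>_def)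
    with map show "xs \<in> (\<lambda>\<sigma>. map \<sigma> [1..<Suc n]) ` {\<sigma>. \<sigma> permutes {1..n}}" by force
  qed
qed

text \<open>Minimality amounts to dominance, which implies alternation, so the bijection between
  permutations and lists restricts to the two sets counted.\<close>

lemma card_minimal_alternating_perms:
  "card {\<sigma> \<in> alternating_perms v n. mmp1000 n \<sigma> = card {i \<in> {1..<n}. odd i = v}} =
     card (dominant_lists v {1..n})"
proof -
  let ?f = "\<lambda>\<sigma>. map \<sigma> [1..<Suc n]"
  let ?R = "{\<sigma>. \<sigma> permutes {1..n} \<and> dominant_peaks v (?f \<sigma>)}"
  have "{\<sigma> \<in> alternating_perms v n. mmp1000 n \<sigma> = card {i \<in> {1..<n}. odd i = v}} = ?R"
  proof (rule Collect_cong)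
    fix \<sigma>
    show "\<sigma> \<in> alternating_perms v n \<and> mmp1000 n \<sigma> = card {i \<in> {1..<n}. odd i = v} \<longleftrightarrow>
        \<sigma> permutes {1..n} \<and> dominant_peaks v (?f \<sigma>)"
    proof (cases "\<sigma> \<in> alternating_perms v n")
      case True
      then have "\<sigma> permutes {1..n}"
        by (simp add: alternating_perms_def)
      with True alternating_perms_mmp1000(2)[OF True] show ?thesis
        by (simp only: simp_thms)
    next
      case False
      with dominant_peaks_imp_alternating[of \<sigma> n v] show ?thesis
        by blast
    qed
  qed
  moreover have "?f ` ?R = {xs \<in> ?f ` {\<sigma>. \<sigma> permutes {1..n}}. dominant_peaks v xs}"
    by (auto simp del: upt_Suc)
  then have "?f ` ?R = dominant_lists v {1..n}"
    unfolding bij_betw_imp_surj_on[OF bij_betw_permutes_distinct_lists[of n]]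
    by (simp only: dominant_lists_def mem_Collect_eq conj_assoc)
  moreover have "inj_on ?f ?R"
    by (rule inj_on_subset[OF bij_betw_imp_inj_on[OF bij_betw_permutes_distinct_lists[of n]]])
      (simp add: Collect_mono)
  ultimately show ?thesis
    using card_image[of ?f ?R] by (simp only:)
qed

section \<open>Lowest coefficients of the generating polynomials\<close>

lemma coeff_sum_monom:
  assumes "finite A"
  shows "coeff (\<Sum>a \<in> A. monom (1 :: 'b :: comm_semiring_1) (f a)) k = of_nat (card {a \<in> A. f a = k})"
  using assms by (simp add: coeff_sum sum.If_cases Int_def conj_commute)

lemma coeff_alternating_poly:
  fixes v :: bool and n :: nat
  defines "P \<equiv> (\<Sum>\<sigma> \<in> alternating_perms v n. monom (1 :: int) (mmp1000 n \<sigma>))"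
    and "m \<equiv> (if v then n div 2 else (n - 1) div 2)"
  shows "k < m \<Longrightarrow> coeff P k = 0"
    and "coeff P m = int (card (dominant_lists v {1..n}))"
proof -
  have m: "m = card {i \<in> {1..<n}. odd i = v}"
    unfolding m_def by (rule card_valleys[symmetric])
  have P: "coeff P k = int (card {\<sigma> \<in> alternating_perms v n. mmp1000 n \<sigma> = k})" for k
    unfolding P_def by (simp add: coeff_sum_monom finite_alternating_perms)
  show "coeff P m = int (card (dominant_lists v {1..n}))"
    unfolding P m card_minimal_alternating_perms ..
  assume "k < m"
  then have "{\<sigma> \<in> alternating_perms v n. mmp1000 n \<sigma> = k} = {}"
    using alternating_perms_mmp1000(1) m by fastforce
  then show "coeff P k = 0"
    unfolding P by (simp only: card.empty of_nat_0)
qed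

lemma coeff_UD_poly:
  fixes n :: nat
  defines "P \<equiv> (\<Sum>\<sigma> \<in> UD n. monom (1 :: int) (mmp1000 n \<sigma>))"
  shows "k < n div 2 \<Longrightarrow> coeff P k = 0"
    and "coeff P (n div 2) = int (double_fact (n - 1))"
  using coeff_alternating_poly(1)[where v = True and n = n and k = k]
    coeff_alternating_poly(2)[where v = True and n = n]
  by (simp_all add: P_def UD_eq_alternating_perms card_dominant_lists_True)

lemma coeff_DU_poly:
  fixes n :: nat
  assumes "n \<ge> 1"
  defines "P \<equiv> (\<Sum>\<sigma> \<in> DU n. monom (1 :: int) (mmp1000 n \<sigma>))"
  shows "k < (n - 1) div 2 \<Longrightarrow> coeff P k = 0"
    and "coeff P ((n - 1) div 2) = int (double_fact (n - 2))"
proof -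
  have "Max {1..n} = n" using assms(1) by (intro Max_eqI) auto
  \<comment> \<open>The leading maximum \<open>n\<close> is removed first, leaving
    \<open>n - 1\<close> values and thus the argument \<open>n - 2\<close>.\<close>
  then have "card (dominant_lists False {1..n}) = double_fact (n - 2)"
    using assms(1) by (simp add: card_dominant_lists_False card_dominant_lists_True numeral_2_eq_2)
  then show "k < (n - 1) div 2 \<Longrightarrow> coeff P k = 0"
    and "coeff P ((n - 1) div 2) = int (double_fact (n - 2))"
    using coeff_alternating_poly(1)[where v = False and n = n and k = k]
      coeff_alternating_poly(2)[where v = False and n = n]
    by (simp_all add: P_def DU_eq_alternating_perms)
qed

theorem theorem3p1:
  shows "(\<forall>n\<ge>1. (\<forall>k<n. coeff (A_poly (2 * n)) k = 0) \<and>
            coeff (A_poly (2 * n)) n = int (double_fact (2 * n - 1))) \<and>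
         (\<forall>n\<ge>1. (\<forall>k<n. coeff (B_poly (2 * n + 1)) k = 0) \<and>
            coeff (B_poly (2 * n + 1)) n = int (double_fact (2 * n))) \<and>
         (\<forall>n\<ge>1. (\<forall>k<n - 1. coeff (C_poly (2 * n)) k = 0) \<and>
            coeff (C_poly (2 * n)) (n - 1) = int (double_fact (2 * (n - 1)))) \<and>
         (\<forall>n\<ge>1. (\<forall>k<n. coeff (D_poly (2 * n + 1)) k = 0) \<and>
            coeff (D_poly (2 * n + 1)) n = int (double_fact (2 * n - 1)))"
proof (intro conjI allI impI)
  fix n k :: nat
  assume n: "1 \<le> n"
  show "coeff (A_poly (2 * n)) n = int (double_fact (2 * n - 1))"
    using coeff_UD_poly(2)[of "2 * n"] by (simp add: A_poly_def)
  show "coeff (B_poly (2 * n + 1)) n = int (double_fact (2 * n))"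
    using coeff_UD_poly(2)[of "2 * n + 1"] by (simp add: B_poly_def)
  \<comment> \<open>In a down-up permutation of length \<open>2 * n\<close> the last position is a
    valley without successor, so only \<open>n - 1\<close> valleys count.\<close>
  have half: "(2 * n - 1) div 2 = n - 1" using n by linarith
  show "coeff (C_poly (2 * n)) (n - 1) = int (double_fact (2 * (n - 1)))"
    using coeff_DU_poly(2)[of "2 * n"] n half by (simp add: C_poly_def right_diff_distrib')
  show "coeff (D_poly (2 * n + 1)) n = int (double_fact (2 * n - 1))"
    using coeff_DU_poly(2)[of "2 * n + 1"] by (simp add: D_poly_def)
  show "coeff (C_poly (2 * n)) k = 0" if "k < n - 1"
    using coeff_DU_poly(1)[of "2 * n" k] n half that by (simp add: C_poly_def)
  assume "k < n"
  then show "coeff (A_poly (2 * n)) k = 0" "coeff (B_poly (2 * n + 1)) k = 0"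
    "coeff (D_poly (2 * n + 1)) k = 0"
    using coeff_UD_poly(1)[of k "2 * n"] coeff_UD_poly(1)[of k "2 * n + 1"]
      coeff_DU_poly(1)[of "2 * n + 1" k]
    by (simp_all add: A_poly_def B_poly_def D_poly_def)
qed

end
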